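(* Let $n$ and $a$ be non-negative integers, and let $m$ be a positive integer. Let $$R(n,m,a)=\sum_{k=0}^{n}\binom{n}{k}^m G(n,k,a),$$ where $G(n,k,a)$ is an integer-valued function, and let $$Q(n,m,a)=\sum_{k=0}^{n}\binom{n}{k}^m H(n,k,a),\qquad\text{where } H(n,k,a)=\binom{a+k}{a}\binom{a+n-k}{a}G(n,k,a).$$ Then for every non-negative integer $j$ with $j\le\lfloor n/2\rfloor$, $$M_Q(n,j,0;a)=\binom{a+j}{a}\sum_{l=0}^{a}\binom{n-j+l}{l}\binom{n-j}{a-l}\,M_R(n,j+a-l,0;a).$$
   Context: Definition of $M$ sums: let $n,a$ be non-negative integers and $m$ a positive integer, and let $S(n,m,a)=\sum_{k=0}^{n}\binom{n}{k}^m F(n,k,a)$, where $F(n,k,a)$ is an integer-valued function. For non-negative integers $j$ and $t$ with $j\le\lfloor n/2\rfloor$, the $M$ sums for $S$ are $$M_S(n,j,t;a)=\binom{n-j}{j}\sum_{v=0}^{n-2j}\binom{n-2j}{v}\binom{n}{j+v}^t F(n,j+v,a).$$ Thus $M_Q$ is formed with $F=H$ and $M_R$ is formed with $F=G$; the $M$ sums do not depend on $m$. Convention: when $j>\lfloor n/2\rfloor$ the sum defining $M_S(n,j,t;a)$ is empty, so $M_S(n,j,t;a)=0$. Also $\binom{p}{q}=0$ for non-negative integers $q>p$. *)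

theory Defs
  imports Complex_Main
begin

definition binom_sum :: "(nat \<Rightarrow> nat \<Rightarrow> nat \<Rightarrow> int) \<Rightarrow> nat \<Rightarrow> nat \<Rightarrow> nat \<Rightarrow> int" where
  "binom_sum F n m a = (\<Sum>k = 0..n. int (n choose k) ^ m * F n k a)"

(* M_sum F n j t a is M_S(n,j,t;a) for S = binom_sum F. It takes the summand F rather than S as
   its argument, because the values of S need not determine F. The else branch is the
   empty-sum convention for j > floor(n/2); without it, truncated subtraction would turn
   the range of v into {0..0} instead of the empty set. *)
definition M_sum :: "(nat \<Rightarrow> nat \<Rightarrow> nat \<Rightarrow> int) \<Rightarrow> nat \<Rightarrow> nat \<Rightarrow> nat \<Rightarrow> nat \<Rightarrow> int" where
  "M_sum F n j t a =
    (if j \<le> n div 2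
     then int ((n - j) choose j) *
       (\<Sum>v = 0..n - 2 * j. int ((n - 2 * j) choose v) * int (n choose (j + v)) ^ t * F n (j + v) a)
     else 0)"

end

theory Submission
  imports Defs
begin

text \<open>
  Both sides of the identity are linear in the values \<open>G n k a\<close>, so it suffices to compare the
  coefficient of each one. For exponent zero the coefficient of \<open>F n k a\<close> in \<open>M_sum F n j 0 a\<close> is
  the trinomial coefficient \<open>((n - j) choose k) * (k choose j)\<close>
  (\<open>M_sum_zero_exponent\<close>). In this form it vanishes by itself for \<open>k < j\<close>, for \<open>k > n - j\<close> and
  for \<open>j > n div 2\<close>, so that the empty-sum convention needs no separate treatment and all sums
  can run over every \<open>k \<le> n\<close>.

  With \<open>q = n - j - k\<close> and \<open>i = a - l\<close>, a few regroupings of multinomial coefficients cancel the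
  common factors of the two coefficients, and what remains is
  \[ \sum_i \binom{q}{i} \binom{k}{j+i} \binom{q+k+a-i}{q+k}
       = \binom{q+j+a}{a} \binom{k+a}{j+a}, \]
  a form of the Pfaff--Saalschuetz summation (\<open>saalschuetz_binomial\<close>). It follows from
  applying the Vandermonde convolution three times: one application expands the last factor on
  the left, the second carries out the sum over \<open>i\<close>, and the third collapses the sum that the
  expansion introduced.
\<close>

lemma vandermonde_shifted:
  fixes m k j :: nat
  shows "(\<Sum>i\<le>m. (m choose i) * (k choose (j + i))) = (m + k) choose (m + j)"
proof -
  have "(\<Sum>i\<le>m. (m choose i) * (k choose (j + i)))
      = (\<Sum>i\<le>m. (m choose (m - i)) * (k choose (j + (m - i))))"
    by (rule sum.reindex_bij_witness[of _ "\<lambda>i. m - i" "\<lambda>i. m - i"]) auto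
  also have "\<dots> = (\<Sum>i\<le>m. (m choose i) * (k choose (m + j - i)))"
    by (intro sum.cong refl) (simp add: binomial_symmetric[symmetric] add.commute)
  also have "\<dots> = (\<Sum>i\<le>m + j. (m choose i) * (k choose (m + j - i)))"
    by (intro sum.mono_neutral_left) (auto simp: binomial_eq_0)
  also have "\<dots> = (m + k) choose (m + j)"
    by (rule vandermonde)
  finally show ?thesis .
qed

text \<open>
  Disjoint sets of sizes \<open>i\<close> and \<open>k\<close> can be chosen from \<open>N\<close> points in either order; if \<open>N < i + k\<close>
  there are none, and both sides vanish.
\<close>

lemma choose_disjoint_commute:
  fixes N i k :: nat
  shows "(N choose i) * ((N - i) choose k) = (N choose k) * ((N - k) choose i)"
proof (cases "i + k \<le> N")
  case True
  then have "(N choose (i + k)) * ((i + k) choose i) = (N choose i) * ((N - i) choose k)"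
    and "(N choose (i + k)) * ((i + k) choose k) = (N choose k) * ((N - k) choose i)"
    using choose_mult[of i "i + k" N] choose_mult[of k "i + k" N] by simp_all
  then show ?thesis
    using binomial_symmetric[of i "i + k"] by simp
next
  case False
  then show ?thesis
    by (cases "i \<le> N"; cases "k \<le> N") (auto simp: binomial_eq_0)
qed

lemma saalschuetz_binomial:
  fixes q k j a :: nat
  shows "(\<Sum>i\<le>a. (q choose i) * (k choose (j + i)) * ((q + k + a - i) choose (q + k)))
    = ((q + j + a) choose a) * ((k + a) choose (j + a))"
proof (cases "j \<le> k")
  case False
  then show ?thesis by (simp add: binomial_eq_0)
next
  case True
  let ?f = "\<lambda>i. (q choose i) * (k choose (j + i)) * ((q + k + a - i) choose (q + k))"
  \<comment> \<open>Expand the last factor, writing the summation index of the convolution as \<open>r - i\<close>; then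
    \<open>r\<close> ranges over a set independent of \<open>i\<close>.\<close>
  have expand: "(q choose i) * ((q + k + a - i) choose (q + k))
      = (\<Sum>r\<le>q. (q choose r) * (r choose i) * ((k + a) choose (k + r)))" if i: "i \<le> q" for i
  proof -
    have "(q + k + a - i) choose (q + k) = ((q - i) + (k + a)) choose ((q - i) + (k + i))"
      using i by (simp add: algebra_simps)
    also have "\<dots> = (\<Sum>t\<le>q - i. ((q - i) choose t) * ((k + a) choose (k + i + t)))"
      by (rule vandermonde_shifted[symmetric])
    finally have "(q choose i) * ((q + k + a - i) choose (q + k))
        = (\<Sum>t\<le>q - i. (q choose i) * ((q - i) choose t) * ((k + a) choose (k + i + t)))"
      by (simp add: sum_distrib_left mult.assoc)
    also have "\<dots> = (\<Sum>r\<in>{i..q}. (q choose i) * ((q - i) choose (r - i)) * ((k + a) choose (k + r)))"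
      using i by (intro sum.reindex_bij_witness[of _ "\<lambda>r. r - i" "\<lambda>t. t + i"]) (auto simp: ac_simps)
    also have "\<dots> = (\<Sum>r\<in>{i..q}. (q choose r) * (r choose i) * ((k + a) choose (k + r)))"
      by (intro sum.cong refl) (simp add: choose_mult)
    also have "\<dots> = (\<Sum>r\<le>q. (q choose r) * (r choose i) * ((k + a) choose (k + r)))"
      by (intro sum.mono_neutral_left) (auto simp: binomial_eq_0)
    finally show ?thesis .
  qed
  have inner: "(\<Sum>i\<le>q. (r choose i) * (k choose (j + i))) = (r + k) choose (r + j)" if "r \<le> q" for r
  proof -
    have "(\<Sum>i\<le>q. (r choose i) * (k choose (j + i))) = (\<Sum>i\<le>r. (r choose i) * (k choose (j + i)))"
      using that by (intro sum.mono_neutral_right) (auto simp: binomial_eq_0)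
    then show ?thesis by (simp add: vandermonde_shifted)
  qed
  \<comment> \<open>Separating off a factor that does not depend on \<open>r\<close>.\<close>
  have regroup: "((k + a) choose (k + r)) * ((r + k) choose (r + j))
      = ((k + a) choose (j + a)) * ((a + j) choose (j + r))" for r
  proof (cases "r \<le> a")
    case r: True
    have "(r + k) choose (r + j) = (k + r) choose (k - j)"
      using True binomial_symmetric[of "r + j" "r + k"] by (simp add: add.commute)
    moreover have "(k + a) choose (j + a) = (k + a) choose (k - j)"
      using True binomial_symmetric[of "j + a" "k + a"] by simp
    moreover have "((k + a) choose (k + r)) * ((k + r) choose (k - j))
        = ((k + a) choose (k - j)) * ((a + j) choose (j + r))"
      using choose_mult[of "k - j" "k + r" "k + a"] True r by (simp add: algebra_simps)
    ultimately show ?thesis by simp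
  qed (simp add: binomial_eq_0)
  have "(\<Sum>i\<le>a. ?f i) = (\<Sum>i\<le>min a q. ?f i)"
    by (intro sum.mono_neutral_right) (auto simp: binomial_eq_0)
  also have "\<dots> = (\<Sum>i\<le>q. ?f i)"
    by (intro sum.mono_neutral_left) (auto simp: binomial_eq_0)
  also have "\<dots> = (\<Sum>i\<le>q. \<Sum>r\<le>q. (q choose r) * ((k + a) choose (k + r))
      * ((r choose i) * (k choose (j + i))))"
  proof (intro sum.cong refl)
    fix i assume "i \<in> {..q}"
    then have "?f i = (k choose (j + i))
        * (\<Sum>r\<le>q. (q choose r) * (r choose i) * ((k + a) choose (k + r)))"
      using expand[of i] by (simp add: mult.commute mult.left_commute)
    then show "?f i = (\<Sum>r\<le>q. (q choose r) * ((k + a) choose (k + r))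
        * ((r choose i) * (k choose (j + i))))"
      by (simp add: sum_distrib_left ac_simps)
  qed
  also have "\<dots> = (\<Sum>r\<le>q. (q choose r) * ((k + a) choose (k + r))
      * (\<Sum>i\<le>q. (r choose i) * (k choose (j + i))))"
    unfolding sum_distrib_left by (rule sum.swap)
  also have "\<dots> = (\<Sum>r\<le>q. ((k + a) choose (j + a)) * ((q choose r) * ((a + j) choose (j + r))))"
  proof (intro sum.cong refl)
    fix r assume "r \<in> {..q}"
    then show "(q choose r) * ((k + a) choose (k + r)) * (\<Sum>i\<le>q. (r choose i) * (k choose (j + i)))
        = ((k + a) choose (j + a)) * ((q choose r) * ((a + j) choose (j + r)))"
      using regroup[of r] by (simp add: inner mult.assoc mult.left_commute)
  qed
  also have "\<dots> = ((k + a) choose (j + a)) * ((q + (a + j)) choose (q + j))"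
    by (simp only: sum_distrib_left[symmetric] vandermonde_shifted)
  also have "(q + (a + j)) choose (q + j) = (q + j + a) choose a"
    using binomial_symmetric[of a "q + j + a"] by (simp add: ac_simps)
  finally show ?thesis by (simp add: mult.commute)
qed

text \<open>
  The trinomial coefficient counting the choice of disjoint sets of sizes \<open>j\<close>, \<open>k - j\<close> and
  \<open>n - j - k\<close> in \<open>n - j\<close> points, written so that its zeros reproduce both the range of summation
  and the empty-sum convention.
\<close>

lemma M_sum_zero_exponent:
  "M_sum F n j 0 a = (\<Sum>k\<le>n. int (((n - j) choose k) * (k choose j)) * F n k a)"
proof (cases "j \<le> n div 2")
  case False
  have "((n - j) choose k) * (k choose j) = 0" for k
    using False by (cases "k < j") (auto simp: binomial_eq_0)
  then show ?thesis
    using False by (simp only: M_sum_def if_False of_nat_0 mult_zero_left sum.neutral_const)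
next
  case True
  have coeff: "((n - j) choose j) * ((n - 2 * j) choose (k - j)) = ((n - j) choose k) * (k choose j)"
    if "j \<le> k" "k \<le> n - j" for k
    using choose_mult[of j k "n - j"] that by (simp add: mult_2)
  have "M_sum F n j 0 a
      = (\<Sum>v = 0..n - 2 * j. int (((n - j) choose j) * ((n - 2 * j) choose v)) * F n (j + v) a)"
    using True by (simp add: M_sum_def sum_distrib_left mult.assoc)
  also have "\<dots> = (\<Sum>k\<in>{j..n - j}. int (((n - j) choose j) * ((n - 2 * j) choose (k - j))) * F n k a)"
    using True by (intro sum.reindex_bij_witness[of _ "\<lambda>k. k - j" "\<lambda>v. j + v"]) auto
  also have "\<dots> = (\<Sum>k\<in>{j..n - j}. int (((n - j) choose k) * (k choose j)) * F n k a)"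
    by (intro sum.cong refl) (simp only: coeff atLeastAtMost_iff)
  also have "\<dots> = (\<Sum>k\<le>n. int (((n - j) choose k) * (k choose j)) * F n k a)"
    by (intro sum.mono_neutral_left) (auto simp: binomial_eq_0 not_le)
  finally show ?thesis .
qed

text \<open>
  The theorem compared coefficient by coefficient: after extracting \<open>(n - j) choose k\<close> from every
  term, the sum is the one evaluated by \<open>saalschuetz_binomial\<close>.
\<close>

lemma M_sum_coefficient_identity:
  fixes n j k a :: nat
  assumes "j \<le> n"
  shows "((n - j) choose k) * (k choose j) * (((a + k) choose a) * ((a + n - k) choose a))
    = ((a + j) choose a) * (\<Sum>l = 0..a. ((n - j + l) choose l) * ((n - j) choose (a - l))
        * (((n - (j + a - l)) choose k) * (k choose (j + a - l))))"
proof (cases "k \<le> n - j \<and> j \<le> k")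
  case False
  have "((n - (j + a - l)) choose k) * (k choose (j + a - l)) = 0" if "l \<le> a" for l
    using False that by (auto simp: binomial_eq_0 not_le)
  then have "(\<Sum>l = 0..a. ((n - j + l) choose l) * ((n - j) choose (a - l))
      * (((n - (j + a - l)) choose k) * (k choose (j + a - l)))) = 0"
    by (intro sum.neutral) (simp del: mult_eq_0_iff)
  moreover have "((n - j) choose k) * (k choose j) = 0"
    using False by (auto simp: binomial_eq_0 not_le)
  ultimately show ?thesis by (simp only: mult_zero_left mult_zero_right)
next
  case True
  define q where "q = n - j - k"
  have N: "n - j = q + k" and n: "n = q + k + j"
    using True assms by (auto simp: q_def)
  have "(\<Sum>l = 0..a. ((n - j + l) choose l) * ((n - j) choose (a - l))
        * (((n - (j + a - l)) choose k) * (k choose (j + a - l))))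
      = (\<Sum>i\<le>a. ((q + k + a - i) choose (a - i)) * ((q + k) choose i)
        * (((q + k - i) choose k) * (k choose (j + i))))"
    by (rule sum.reindex_bij_witness[of _ "\<lambda>i. a - i" "\<lambda>l. a - l"]) (auto simp: n add.assoc)
  also have "\<dots> = (\<Sum>i\<le>a. ((q + k) choose k)
      * ((q choose i) * (k choose (j + i)) * ((q + k + a - i) choose (q + k))))"
  proof (intro sum.cong refl)
    fix i assume "i \<in> {..a}"
    then have sym: "(q + k + a - i) choose (a - i) = (q + k + a - i) choose (q + k)"
      using binomial_symmetric[of "a - i" "q + k + a - i"] by simp
    have swap: "((q + k) choose i) * ((q + k - i) choose k) = ((q + k) choose k) * (q choose i)"
      using choose_disjoint_commute[of "q + k" i k] by simp
    have "((q + k + a - i) choose (a - i)) * ((q + k) choose i)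
          * (((q + k - i) choose k) * (k choose (j + i)))
        = (((q + k) choose i) * ((q + k - i) choose k))
          * ((k choose (j + i)) * ((q + k + a - i) choose (q + k)))"
      unfolding sym by (simp only: ac_simps)
    then show "((q + k + a - i) choose (a - i)) * ((q + k) choose i)
          * (((q + k - i) choose k) * (k choose (j + i)))
        = ((q + k) choose k)
          * ((q choose i) * (k choose (j + i)) * ((q + k + a - i) choose (q + k)))"
      by (simp only: swap mult.assoc)
  qed
  also have "\<dots> = ((q + k) choose k) * (((q + j + a) choose a) * ((k + a) choose (j + a)))"
    by (simp only: sum_distrib_left[symmetric] saalschuetz_binomial)
  finally have S: "(\<Sum>l = 0..a. ((n - j + l) choose l) * ((n - j) choose (a - l))
        * (((n - (j + a - l)) choose k) * (k choose (j + a - l))))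
      = ((q + k) choose k) * (((q + j + a) choose a) * ((k + a) choose (j + a)))" .
  have top: "a + n - k = q + j + a" using n by simp
  have absorb: "((a + k) choose a) * (k choose j) = ((k + a) choose (j + a)) * ((a + j) choose a)"
    using choose_mult[of a "j + a" "k + a"] True by (simp add: add.commute)
  have "((q + k) choose k) * (k choose j) * (((a + k) choose a) * ((q + j + a) choose a))
      = ((q + k) choose k) * ((q + j + a) choose a) * (((a + k) choose a) * (k choose j))"
    by (simp only: ac_simps)
  also have "\<dots> = ((a + j) choose a)
      * (((q + k) choose k) * (((q + j + a) choose a) * ((k + a) choose (j + a))))"
    unfolding absorb by (simp only: ac_simps)
  finally show ?thesis
    unfolding S unfolding N top .
qed

theorem theorem2:
  fixes n a m j :: nat
    and G H :: "nat \<Rightarrow> nat \<Rightarrow> nat \<Rightarrow> int"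
    and R Q :: "nat \<Rightarrow> nat \<Rightarrow> nat \<Rightarrow> int"
  assumes "m > 0"
    and "R n m a = binom_sum G n m a"
    and "\<And>n k a. k \<le> n \<Longrightarrow>
      H n k a = int ((a + k) choose a) * int ((a + n - k) choose a) * G n k a"
    and "Q n m a = binom_sum H n m a"
    and "j \<le> n div 2"
  shows "M_sum H n j 0 a =
    int ((a + j) choose a) *
      (\<Sum>l = 0..a. int ((n - j + l) choose l) * int ((n - j) choose (a - l)) *
        M_sum G n (j + a - l) 0 a)"
proof -
  have jn: "j \<le> n" using assms(5) by linarith
  have "M_sum H n j 0 a = (\<Sum>k\<le>n. int (((n - j) choose k) * (k choose j)
      * (((a + k) choose a) * ((a + n - k) choose a))) * G n k a)"
    unfolding M_sum_zero_exponent by (intro sum.cong refl) (simp add: assms(3))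
  also have "\<dots> = (\<Sum>k\<le>n. \<Sum>l = 0..a. int ((a + j) choose a)
      * (int ((n - j + l) choose l) * int ((n - j) choose (a - l))
      * (int (((n - (j + a - l)) choose k) * (k choose (j + a - l))) * G n k a)))"
    unfolding M_sum_coefficient_identity[OF jn]
    by (simp add: sum_distrib_left sum_distrib_right mult.assoc)
  also have "\<dots> = (\<Sum>l = 0..a. \<Sum>k\<le>n. int ((a + j) choose a)
      * (int ((n - j + l) choose l) * int ((n - j) choose (a - l))
      * (int (((n - (j + a - l)) choose k) * (k choose (j + a - l))) * G n k a)))"
    by (rule sum.swap)
  finally show ?thesis
    by (simp only: M_sum_zero_exponent sum_distrib_left)
qed

end
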